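(* Let $G$ be a finite simple graph with vertex set $\{x_1,\dots,x_n\}$, let $k$ be any field, and $R=k[x_1,\dots,x_n]$. Suppose $V(G)$ can be partitioned into a set $J_0$ that is independent (no two vertices of $J_0$ adjacent) together with $s$ sets $J_1,\dots,J_s$ each of which is a clique (pairwise adjacent vertices). Then $\operatorname{reg}\bigl(R/\mathcal{I}(G)\bigr)\le s$.
   Context: The edge ideal of $G$ is $\mathcal{I}(G)=(x_ix_j : \{x_i,x_j\}\in E(G))\subseteq R$; $\operatorname{reg}$ denotes Castelnuovo–Mumford regularity. Cliques need not be maximal. *)

theory Defs
  imports
    Complex_Main
    "HOL-Library.Poly_Mapping"
    "HOL-Library.Disjoint_Sets"
    "HOL-Library.Extended_Real"
    "Jordan_Normal_Form.Matrix_Kernel"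
begin

section \<open>Finite simple graphs\<close>

text \<open>
  The vertex set is the whole of a finite type \<open>'v\<close>, whose elements also index the variables
  of the polynomial ring; a graph is given by its set of edges.
\<close>

definition simple_graph :: "'v::finite set set \<Rightarrow> bool" where
  "simple_graph E \<longleftrightarrow> (\<forall>e\<in>E. card e = 2)"

definition independent_set :: "'v set set \<Rightarrow> 'v set \<Rightarrow> bool" where
  "independent_set E A \<longleftrightarrow> (\<forall>x\<in>A. \<forall>y\<in>A. {x, y} \<notin> E)"

definition clique :: "'v set set \<Rightarrow> 'v set \<Rightarrow> bool" where
  "clique E A \<longleftrightarrow> (\<forall>x\<in>A. \<forall>y\<in>A. x \<noteq> y \<longrightarrow> {x, y} \<in> E)"


section \<open>The polynomial ring and the edge ideal\<close>

text \<open>A monomial is its exponent vector; a polynomial maps monomials to coefficients.\<close>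

type_synonym ('v, 'k) mpoly = "('v \<Rightarrow>\<^sub>0 nat) \<Rightarrow>\<^sub>0 'k"

definition Var :: "'v \<Rightarrow> ('v, 'k::field) mpoly" where
  "Var v = Poly_Mapping.single (Poly_Mapping.single v 1) 1"

text \<open>
  A commutative ring is a module over itself, and the submodule spanned by a set is the ideal
  it generates. The qualified name is needed since \<open>HOL-Algebra\<close> also has a locale \<open>module\<close>.
\<close>

definition ideal_generated :: "'a::comm_ring_1 set \<Rightarrow> 'a set" where
  "ideal_generated S = Modules.module.span (*) S"

definition edge_ideal :: "'v::finite set set \<Rightarrow> ('v, 'k::field) mpoly set" where
  "edge_ideal E = ideal_generated {Var x * Var y | x y. {x, y} \<in> E}"

definition irrelevant_ideal :: "('v::finite, 'k::field) mpoly set" where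
  "irrelevant_ideal = ideal_generated (range Var)"

definition monomial_degree :: "('v \<Rightarrow>\<^sub>0 nat) \<Rightarrow> nat" where
  "monomial_degree m = (\<Sum>v\<in>Poly_Mapping.keys m. Poly_Mapping.lookup m v)"

text \<open>Zero is homogeneous of every degree, and nothing else is homogeneous of negative degree.\<close>

definition homogeneous :: "int \<Rightarrow> ('v, 'k::field) mpoly \<Rightarrow> bool" where
  "homogeneous j p \<longleftrightarrow> (\<forall>m\<in>Poly_Mapping.keys p. int (monomial_degree m) = j)"


section \<open>Minimal graded free resolutions and regularity\<close>

text \<open>
  For a homogeneous ideal \<open>I\<close> we describe graded free resolutions of the quotient \<open>R/I\<close>
  \[ \cdots \to F_2 \to F_1 \to F_0 \to R/I \to 0 \]
  by finite free modules with chosen homogeneous bases. The list \<open>d i\<close> contains the degrees of the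
  basis elements of \<open>F\<^sub>i\<close>, so that \<open>F\<^sub>i\<close> is the direct sum of the twists \<open>R(-j)\<close> for the
  entries \<open>j\<close> of \<open>d i\<close>. The matrix \<open>D i\<close> represents the differential from
  \<open>F\<^bsub>i+1\<^esub>\<close> to \<open>F\<^sub>i\<close>, and \<open>\<epsilon>\<close> lists representatives in \<open>R\<close> of the images in \<open>R/I\<close>
  of the basis elements of \<open>F\<^sub>0\<close>. The maps are graded of degree 0, whence the homogeneity
  conditions on \<open>\<epsilon>\<close> and on the entries of \<open>D i\<close>. The last three conditions are
  exactness at \<open>R/I\<close>, at \<open>F\<^sub>0\<close> and at \<open>F\<^bsub>i+1\<^esub>\<close>.
\<close>

definition graded_free_resolution ::
  "('v::finite, 'k::field) mpoly set \<Rightarrow> (nat \<Rightarrow> int list) \<Rightarrow> (nat \<Rightarrow> ('v, 'k) mpoly mat)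
     \<Rightarrow> ('v, 'k) mpoly vec \<Rightarrow> bool" where
  "graded_free_resolution I d D \<epsilon> \<longleftrightarrow>
     \<epsilon> \<in> carrier_vec (length (d 0)) \<and>
     (\<forall>a<length (d 0). homogeneous (d 0 ! a) (\<epsilon> $ a)) \<and>
     (\<forall>i. D i \<in> carrier_mat (length (d i)) (length (d (Suc i)))) \<and>
     (\<forall>i. \<forall>a<length (d i). \<forall>b<length (d (Suc i)).
        homogeneous (d (Suc i) ! b - d i ! a) (D i $$ (a, b))) \<and>
     (\<forall>p. \<exists>v\<in>carrier_vec (length (d 0)). p - \<epsilon> \<bullet> v \<in> I) \<and>
     {v \<in> carrier_vec (length (d 0)). \<epsilon> \<bullet> v \<in> I}
       = (\<lambda>w. D 0 *\<^sub>v w) ` carrier_vec (length (d 1)) \<and>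
     (\<forall>i. mat_kernel (D i) = (\<lambda>w. D (Suc i) *\<^sub>v w) ` carrier_vec (length (d (Suc (Suc i)))))"

text \<open>
  Minimality: the image of every differential \<open>F\<^bsub>i+1\<^esub> \<rightarrow> F\<^sub>i\<close> lies in \<open>\<mm> F\<^sub>i\<close>, where \<open>\<mm>\<close> is
  the ideal generated by the variables.
\<close>

definition minimal_graded_free_resolution ::
  "('v::finite, 'k::field) mpoly set \<Rightarrow> (nat \<Rightarrow> int list) \<Rightarrow> (nat \<Rightarrow> ('v, 'k) mpoly mat)
     \<Rightarrow> ('v, 'k) mpoly vec \<Rightarrow> bool" where
  "minimal_graded_free_resolution I d D \<epsilon> \<longleftrightarrow>
     graded_free_resolution I d D \<epsilon> \<and>
     (\<forall>i. \<forall>a<length (d i). \<forall>b<length (d (Suc i)). D i $$ (a, b) \<in> irrelevant_ideal)"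

text \<open>
  The Castelnuovo--Mumford regularity of \<open>R/I\<close> for a homogeneous ideal \<open>I\<close>: the largest \<open>j - i\<close>
  such that the graded Betti number \<open>\<beta>\<^bsub>i,j\<^esub>(R/I)\<close> is nonzero, that is, such that the \<open>i\<close>-th module
  of the minimal graded free resolution of \<open>R/I\<close> has a basis element of degree \<open>j\<close>. A minimal
  graded free resolution exists and is unique up to isomorphism, so every choice of it contributes
  the same values. The extended reals give the zero module regularity \<open>-\<infinity>\<close>.
\<close>

definition cm_regularity_quotient :: "('v::finite, 'k::field) mpoly set \<Rightarrow> ereal" where
  "cm_regularity_quotient I =
     Sup {ereal (real_of_int (j - int i)) | i j.
            \<exists>d D \<epsilon>. minimal_graded_free_resolution I d D \<epsilon> \<and> j \<in> set (d i)}"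

end

(*
  Write I(E,W) for the edge ideal with the variables of W adjoined. If x lies in a clique J_i
  and not in W, then (I(E,W), x) = I(E, W + x) and I(E,W) : x = I(E, W + N(x)), and N(x) covers
  the rest of J_i. The exact sequence 0 -> R/(I:x)(-1) -> R/I -> R/(I,x) -> 0 therefore bounds the
  regularity by induction: the shift costs one, but the colon ideal has used up one clique.
  If no clique is left, all remaining vertices are isolated and only variables remain in the ideal.
  Throughout, "reg R/I <= s" is the vanishing of the strands of Koszul homology of R/I above s.
  A basis element of a minimal resolution gives a nonzero Koszul homology class by the usual
  diagram chase that shows Tor to be balanced.
*)

theory Submission
  imports Defs
begin

section \<open>Monomial ideals\<close>

text \<open>An ideal exactly when \<open>up_closed M\<close>. Exponent sets turn colons by a
  variable and adjoining a variable into set operations.\<close>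

definition monomial_ideal :: "('v \<Rightarrow>\<^sub>0 nat) set \<Rightarrow> ('v, 'k::field) mpoly set" where
  "monomial_ideal M = {p. Poly_Mapping.keys p \<subseteq> M}"

definition up_closed :: "('v \<Rightarrow>\<^sub>0 nat) set \<Rightarrow> bool" where
  "up_closed M \<longleftrightarrow> (\<forall>m\<in>M. \<forall>n. n + m \<in> M)"

definition monomial_colon :: "('v \<Rightarrow>\<^sub>0 nat) set \<Rightarrow> 'v \<Rightarrow> ('v \<Rightarrow>\<^sub>0 nat) set" where
  "monomial_colon M x = {m. Poly_Mapping.single x 1 + m \<in> M}"

definition monomial_add :: "('v \<Rightarrow>\<^sub>0 nat) set \<Rightarrow> 'v \<Rightarrow> ('v \<Rightarrow>\<^sub>0 nat) set" where
  "monomial_add M x = M \<union> {m. Poly_Mapping.lookup m x \<noteq> 0}"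

lemma poly_mapping_eq_sum_single:
  fixes p :: "'a \<Rightarrow>\<^sub>0 'b::comm_monoid_add"
  shows "p = (\<Sum>m\<in>Poly_Mapping.keys p. Poly_Mapping.single m (Poly_Mapping.lookup p m))"
proof (rule poly_mapping_eqI)
  fix k
  have "(\<Sum>m\<in>Poly_Mapping.keys p. Poly_Mapping.lookup p m when m = k) = Poly_Mapping.lookup p k"
    by (simp add: when_def sum.delta in_keys_iff)
  then show "Poly_Mapping.lookup p k =
      Poly_Mapping.lookup (\<Sum>m\<in>Poly_Mapping.keys p. Poly_Mapping.single m (Poly_Mapping.lookup p m)) k"
    by (simp add: lookup_sum lookup_single)
qed

lemma lookup_single_one_mult:
  fixes p :: "('v, 'k::field) mpoly"
  shows "Poly_Mapping.lookup (Poly_Mapping.single k 1 * p) (k + m) = Poly_Mapping.lookup p m"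
proof -
  have "Poly_Mapping.single k 1 * p =
      (\<Sum>n\<in>Poly_Mapping.keys p. Poly_Mapping.single (k + n) (Poly_Mapping.lookup p n))"
    by (subst poly_mapping_eq_sum_single[of p]) (simp add: sum_distrib_left mult_single)
  then show ?thesis
    by (simp add: lookup_sum lookup_single when_def sum.delta in_keys_iff)
qed

lemma monomial_ideal_zero [simp]: "0 \<in> monomial_ideal M"
  by (simp add: monomial_ideal_def)

lemma monomial_ideal_add: "p \<in> monomial_ideal M \<Longrightarrow> q \<in> monomial_ideal M \<Longrightarrow> p + q \<in> monomial_ideal M"
  using keys_add[of p q] by (auto simp: monomial_ideal_def)

lemma monomial_ideal_uminus: "p \<in> monomial_ideal M \<Longrightarrow> - p \<in> monomial_ideal M"
  by (auto simp: monomial_ideal_def in_keys_iff)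

lemma monomial_ideal_diff: "p \<in> monomial_ideal M \<Longrightarrow> q \<in> monomial_ideal M \<Longrightarrow> p - q \<in> monomial_ideal M"
  using monomial_ideal_add[of p M "- q"] monomial_ideal_uminus[of q M] by simp

lemma monomial_ideal_mult:
  assumes "up_closed M" "q \<in> monomial_ideal M"
  shows "p * q \<in> monomial_ideal M"
  unfolding monomial_ideal_def
proof (intro CollectI subsetI)
  fix m assume "m \<in> Poly_Mapping.keys (p * q)"
  then obtain a b where "m = a + b" "b \<in> Poly_Mapping.keys q"
    using keys_mult[of p q] by blast
  with assms show "m \<in> M" by (auto simp: monomial_ideal_def up_closed_def)
qed

lemma monomial_ideal_mult_right: "up_closed M \<Longrightarrow> p \<in> monomial_ideal M \<Longrightarrow> p * q \<in> monomial_ideal M"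
  using monomial_ideal_mult[of M p q] by (simp add: mult.commute)

lemma monomial_ideal_sum:
  "(\<And>a. a \<in> A \<Longrightarrow> f a \<in> monomial_ideal M) \<Longrightarrow> sum f A \<in> monomial_ideal M"
  by (induction A rule: infinite_finite_induct) (auto intro: monomial_ideal_add)

lemma monomial_ideal_mono: "M \<subseteq> N \<Longrightarrow> p \<in> monomial_ideal M \<Longrightarrow> p \<in> monomial_ideal N"
  by (auto simp: monomial_ideal_def)

text \<open>Multiplication by a variable shifts exponents injectively, so nothing cancels and every
  monomial of \<open>p\<close> leaves a trace in \<open>Var x * p\<close>.\<close>

lemma monomial_ideal_colon:
  fixes p :: "('v, 'k::field) mpoly"
  assumes "Var x * p \<in> monomial_ideal M"
  shows "p \<in> monomial_ideal (monomial_colon M x)"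
proof -
  have "Poly_Mapping.single x 1 + m \<in> Poly_Mapping.keys (Var x * p)"
    if "m \<in> Poly_Mapping.keys p" for m
    using that by (simp add: in_keys_iff Var_def lookup_single_one_mult)
  with assms show ?thesis
    by (auto simp: monomial_ideal_def monomial_colon_def)
qed

lemma monomial_ideal_colonD:
  assumes "p \<in> monomial_ideal (monomial_colon M x)"
  shows "Var x * p \<in> monomial_ideal M"
  unfolding monomial_ideal_def
proof (intro CollectI subsetI)
  fix m assume "m \<in> Poly_Mapping.keys (Var x * p)"
  then obtain a b where "m = a + b" "a \<in> Poly_Mapping.keys (Var x :: ('a, 'b) mpoly)" "b \<in> Poly_Mapping.keys p"
    using keys_mult[of "Var x" p] by blast
  with assms show "m \<in> M" by (auto simp: monomial_ideal_def monomial_colon_def Var_def)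
qed

lemma up_closed_nonzero: "up_closed {m :: 'v::finite \<Rightarrow>\<^sub>0 nat. m \<noteq> 0}"
  by (auto simp: up_closed_def poly_mapping_eq_iff fun_eq_iff lookup_add)

lemma Var_in_monomial_ideal_nonzero: "Var v \<in> (monomial_ideal {m. m \<noteq> 0} :: ('v, 'k::field) mpoly set)"
  by (auto simp: monomial_ideal_def Var_def poly_mapping_eq_iff fun_eq_iff lookup_single when_def)

section \<open>Homogeneous polynomials and degrees of monomials\<close>

lemma homogeneous_zero [simp]: "homogeneous j 0"
  by (simp add: homogeneous_def)

lemma homogeneous_add: "homogeneous j p \<Longrightarrow> homogeneous j q \<Longrightarrow> homogeneous j (p + q)"
  using keys_add[of p q] by (auto simp: homogeneous_def)

lemma homogeneous_uminus: "homogeneous j p \<Longrightarrow> homogeneous j (- p)"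
  by (auto simp: homogeneous_def in_keys_iff)

lemma homogeneous_diff: "homogeneous j p \<Longrightarrow> homogeneous j q \<Longrightarrow> homogeneous j (p - q)"
  using homogeneous_add[of j p "- q"] homogeneous_uminus[of j q] by simp

lemma homogeneous_sum: "(\<And>a. a \<in> A \<Longrightarrow> homogeneous j (f a)) \<Longrightarrow> homogeneous j (sum f A)"
  by (induction A rule: infinite_finite_induct) (auto intro: homogeneous_add)

lemma monomial_degree_eq_sum: 
  fixes m :: "'v::finite \<Rightarrow>\<^sub>0 nat"
  shows "monomial_degree m = (\<Sum>v\<in>UNIV. Poly_Mapping.lookup m v)"
  unfolding monomial_degree_def by (rule sum.mono_neutral_left) (auto simp: in_keys_iff)

lemma monomial_degree_add:
  fixes m n :: "'v::finite \<Rightarrow>\<^sub>0 nat"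
  shows "monomial_degree (m + n) = monomial_degree m + monomial_degree n"
  by (simp add: monomial_degree_eq_sum lookup_add sum.distrib)

lemma monomial_degree_single [simp]: "monomial_degree (Poly_Mapping.single v n) = n"
  by (simp add: monomial_degree_def)

lemma monomial_degree_zero [simp]: "monomial_degree 0 = 0"
  by (simp add: monomial_degree_def)

lemma monomial_degree_eq_0_iff [simp]:
  fixes m :: "'v::finite \<Rightarrow>\<^sub>0 nat"
  shows "monomial_degree m = 0 \<longleftrightarrow> m = 0"
proof
  assume "monomial_degree m = 0"
  then have "Poly_Mapping.lookup m v = 0" for v
    by (simp add: monomial_degree_eq_sum)
  then show "m = 0" by (intro poly_mapping_eqI) simp
qed simp

lemma homogeneous_mult:
  fixes p q :: "('v::finite, 'k::field) mpoly"
  assumes "homogeneous i p" "homogeneous j q"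
  shows "homogeneous (i + j) (p * q)"
  unfolding homogeneous_def
proof
  fix m assume "m \<in> Poly_Mapping.keys (p * q)"
  then obtain a b where "m = a + b" "a \<in> Poly_Mapping.keys p" "b \<in> Poly_Mapping.keys q"
    using keys_mult[of p q] by blast
  with assms show "int (monomial_degree m) = i + j"
    by (simp add: homogeneous_def monomial_degree_add)
qed

lemma homogeneous_Var_mult:
  fixes p :: "('v::finite, 'k::field) mpoly"
  assumes "homogeneous (j - 1) p"
  shows "homogeneous j (Var v * p)"
proof -
  have "homogeneous 1 (Var v :: ('v, 'k) mpoly)"
    by (simp add: homogeneous_def Var_def monomial_degree_def)
  from homogeneous_mult[OF this assms] show ?thesis by simp
qed

lemma homogeneous_one: "homogeneous 0 (1 :: ('v::finite, 'k::field) mpoly)"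
  by (simp add: homogeneous_def)

text \<open>The terms of \<open>p\<close> outside \<open>M\<close> are all divisible by
  \<open>x\<close>; dividing them by \<open>x\<close> gives \<open>q\<close>.\<close>

lemma monomial_add_decomp:
  fixes p :: "('v::finite, 'k::field) mpoly"
  assumes "p \<in> monomial_ideal (monomial_add M x)" "homogeneous j p"
  shows "\<exists>q. p - Var x * q \<in> monomial_ideal M \<and> homogeneous (j - 1) q"
proof -
  let ?K = "Poly_Mapping.keys p" and ?l = "Poly_Mapping.lookup p"
  let ?x = "Poly_Mapping.single x (1::nat)"
  define q :: "('v, 'k) mpoly" where "q = (\<Sum>m\<in>?K - M. Poly_Mapping.single (m - ?x) (?l m))"
  \<comment> \<open>Subtraction of exponents is truncated; it is exact here because \<open>x\<close>
    divides \<open>m\<close>.\<close>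
  have x: "?x + (m - ?x) = m" if "m \<in> ?K - M" for m
  proof (rule poly_mapping_eqI)
    fix k
    have "Poly_Mapping.lookup m x \<noteq> 0"
      using that assms(1) by (auto simp: monomial_ideal_def monomial_add_def)
    then show "Poly_Mapping.lookup (?x + (m - ?x)) k = Poly_Mapping.lookup m k"
      by (simp add: lookup_add lookup_minus lookup_single when_def) auto
  qed
  have "Var x * q = (\<Sum>m\<in>?K - M. Poly_Mapping.single m (?l m))"
    unfolding q_def Var_def sum_distrib_left mult_single by (rule sum.cong) (simp_all only: x mult_1)
  moreover have "p = (\<Sum>m\<in>?K - M. Poly_Mapping.single m (?l m)) + (\<Sum>m\<in>?K \<inter> M. Poly_Mapping.single m (?l m))"
    using sum.Int_Diff[of ?K "\<lambda>m. Poly_Mapping.single m (?l m)" M] poly_mapping_eq_sum_single[of p]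
    by (simp add: add.commute)
  ultimately have "p - Var x * q = (\<Sum>m\<in>?K \<inter> M. Poly_Mapping.single m (?l m))"
    by (metis add_diff_cancel_left')
  also have "\<dots> \<in> monomial_ideal M"
    by (rule monomial_ideal_sum) (simp add: monomial_ideal_def)
  finally have 1: "p - Var x * q \<in> monomial_ideal M" .
  have "homogeneous (j - 1) (Poly_Mapping.single (m - ?x) (?l m))" if m: "m \<in> ?K - M" for m
  proof -
    have "monomial_degree m = 1 + monomial_degree (m - ?x)"
      using monomial_degree_add[of ?x "m - ?x"] x[OF m] by simp
    moreover have "int (monomial_degree m) = j"
      using assms(2) m by (simp add: homogeneous_def)
    ultimately show ?thesis by (simp add: homogeneous_def)
  qed
  then have "homogeneous (j - 1) q"
    unfolding q_def by (rule homogeneous_sum)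
  with 1 show ?thesis by blast
qed

section \<open>The Koszul complex\<close>

text \<open>The vertex type carries no order, so an arbitrary injection supplies the one behind the
  Koszul signs.\<close>

definition vertex_index :: "'v::finite \<Rightarrow> nat" where
  "vertex_index = (SOME f. inj f)"

lemma inj_vertex_index: "inj (vertex_index :: 'v::finite \<Rightarrow> nat)"
proof -
  have "\<exists>f :: 'v \<Rightarrow> nat. inj f"
    using finite_imp_inj_to_nat_seg[of "UNIV :: 'v set"] by auto
  from someI_ex[OF this] show ?thesis unfolding vertex_index_def .
qed

text \<open>The sign of moving e_v past the factors of smaller index in e_S.\<close>

definition koszul_sign :: "'v::finite \<Rightarrow> 'v set \<Rightarrow> 'a::comm_ring_1" where
  "koszul_sign v S = (- 1) ^ card {u \<in> S. vertex_index u < vertex_index v}"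

text \<open>A chain gives for each set \<open>S\<close> the coefficient of the exterior basis
  element e_S, so all homological degrees are treated together.\<close>

definition koszul_diff :: "('v::finite set \<Rightarrow> ('v, 'k::field) mpoly) \<Rightarrow> 'v set \<Rightarrow> ('v, 'k) mpoly" where
  "koszul_diff z T = (\<Sum>v\<in>- T. koszul_sign v T * Var v * z (insert v T))"

lemma koszul_sign_square [simp]: "koszul_sign v S * koszul_sign v S = 1"
  by (simp add: koszul_sign_def)

lemma koszul_sign_square_left [simp]: "koszul_sign v S * (koszul_sign v S * a) = a"
  using mult.assoc[of "koszul_sign v S" "koszul_sign v S" a] by simp

lemma koszul_sign_insert:
  assumes "u \<notin> S"
  shows "koszul_sign v (insert u S) =
    (if vertex_index u < vertex_index v then - koszul_sign v S else koszul_sign v S)"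
proof -
  have "{w \<in> insert u S. vertex_index w < vertex_index v} =
    (if vertex_index u < vertex_index v then insert u {w \<in> S. vertex_index w < vertex_index v}
     else {w \<in> S. vertex_index w < vertex_index v})" by auto
  with assms show ?thesis by (simp add: koszul_sign_def)
qed

text \<open>Exactly one of \<open>u\<close>, \<open>v\<close> has the smaller index, so exactly one
  of the two insertions flips a sign.\<close>

lemma koszul_sign_anticommute:
  assumes "u \<notin> S" "v \<notin> S" "u \<noteq> v"
  shows "koszul_sign u S * koszul_sign v (insert u S) = - (koszul_sign v S * koszul_sign u (insert v S))"
proof -
  have "vertex_index u \<noteq> vertex_index v"
    using assms(3) inj_vertex_index by (auto dest: injD)
  then show ?thesis using assms by (auto simp: koszul_sign_insert mult.commute)
qed

lemma koszul_diff_add: "koszul_diff (\<lambda>S. f S + g S) T = koszul_diff f T + koszul_diff g T"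
  by (simp add: koszul_diff_def algebra_simps sum.distrib)

lemma koszul_diff_diff: "koszul_diff (\<lambda>S. f S - g S) T = koszul_diff f T - koszul_diff g T"
  by (simp add: koszul_diff_def algebra_simps sum_subtractf)

lemma koszul_diff_mult: "koszul_diff (\<lambda>S. a * f S) T = a * koszul_diff f T"
  by (simp add: koszul_diff_def sum_distrib_left mult_ac)

lemma koszul_diff_sum: "koszul_diff (\<lambda>S. \<Sum>b\<in>B. f b S) T = (\<Sum>b\<in>B. koszul_diff (f b) T)"
  unfolding koszul_diff_def by (simp add: sum_distrib_left) (rule sum.swap)

lemma koszul_diff_koszul_diff: "koszul_diff (koszul_diff z) T = 0"
proof -
  define f where "f v u = koszul_sign v T * Var v * (koszul_sign u (insert v T) * Var u * z (insert u (insert v T)))" for v u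
  have anti: "f v u = - f u v" if "u \<notin> T" "v \<notin> T" "u \<noteq> v" for u v
  proof -
    have "f v u = (koszul_sign v T * koszul_sign u (insert v T)) * (Var v * Var u * z (insert u (insert v T)))"
      by (simp add: f_def mult_ac)
    also have "\<dots> = - ((koszul_sign u T * koszul_sign v (insert u T)) * (Var u * Var v * z (insert v (insert u T))))"
      using that koszul_sign_anticommute[of v T u, where ?'b = "('a, 'b) mpoly"] by (simp add: insert_commute mult_ac)
    also have "\<dots> = - f u v" by (simp add: f_def mult_ac)
    finally show ?thesis .
  qed
  \<comment> \<open>Pairs are split by index and matched by swapping. Antisymmetry alone would only
    show that the sum is its own negative, which says nothing in characteristic 2.\<close>
  let ?P = "SIGMA v:- T. - insert v T"
  let ?A = "{p \<in> ?P. vertex_index (fst p) < vertex_index (snd p)}"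
  let ?B = "{p \<in> ?P. vertex_index (snd p) < vertex_index (fst p)}"
  have "koszul_diff (koszul_diff z) T = (\<Sum>v\<in>- T. \<Sum>u\<in>- insert v T. f v u)"
    by (simp add: koszul_diff_def f_def sum_distrib_left)
  also have "\<dots> = (\<Sum>p\<in>?P. f (fst p) (snd p))"
    by (subst sum.Sigma) (auto simp: case_prod_unfold)
  also have "?P = ?A \<union> ?B"
  proof -
    have "vertex_index v < vertex_index u \<or> vertex_index u < vertex_index v" if "u \<noteq> v" for u v :: 'a
      using that inj_vertex_index by (metis injD linorder_neqE_nat)
    then show ?thesis by fastforce
  qed
  also have "(\<Sum>p\<in>?A \<union> ?B. f (fst p) (snd p)) = (\<Sum>p\<in>?A. f (fst p) (snd p)) + (\<Sum>p\<in>?B. f (fst p) (snd p))"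
    by (rule sum.union_disjoint) auto
  also have "(\<Sum>p\<in>?B. f (fst p) (snd p)) = (\<Sum>p\<in>?A. f (snd p) (fst p))"
    by (rule sum.reindex_bij_witness[of _ prod.swap prod.swap]) auto
  also have "\<dots> = (\<Sum>p\<in>?A. - f (fst p) (snd p))"
    by (rule sum.cong) (auto intro: anti)
  finally show ?thesis by (simp add: sum_negf)
qed

lemma koszul_diff_in_monomial_ideal:
  assumes "up_closed M" "\<And>S. z S \<in> monomial_ideal M"
  shows "koszul_diff z T \<in> monomial_ideal M"
  unfolding koszul_diff_def by (intro monomial_ideal_sum monomial_ideal_mult assms)

text \<open>Left exterior multiplication by e_x.\<close>

definition koszul_wedge :: "'v::finite \<Rightarrow> ('v set \<Rightarrow> ('v, 'k::field) mpoly) \<Rightarrow> 'v set \<Rightarrow> ('v, 'k) mpoly" where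
  "koszul_wedge x y S = (if x \<in> S then koszul_sign x (S - {x}) * y (S - {x}) else 0)"

text \<open>The homotopy formula by which \<open>x\<close> acts as zero on Koszul homology.\<close>

lemma koszul_diff_wedge:
  "koszul_diff (koszul_wedge x y) T = Var x * y T - koszul_wedge x (koszul_diff y) T"
proof (cases "x \<in> T")
  case False
  have "koszul_diff (koszul_wedge x y) T =
      (\<Sum>v\<in>- T. if v = x then Var x * y T else 0)"
    unfolding koszul_diff_def koszul_wedge_def
    using False by (intro sum.cong) (auto simp: mult_ac)
  then show ?thesis using False by (simp add: koszul_wedge_def)
next
  case True
  define U where "U = T - {x}"
  have T: "T = insert x U" "x \<notin> U" using True by (auto simp: U_def)
  \<comment> \<open>Removing \<open>x\<close> from \<open>T\<close> adds \<open>x\<close> to the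
    summation range; its term yields \<open>Var x * y T\<close>.\<close>
  have "- U = insert x (- T)" using T by auto
  then have "koszul_wedge x (koszul_diff y) T = koszul_sign x U * (koszul_sign x U * Var x * y T +
      (\<Sum>v\<in>- T. koszul_sign v U * Var v * y (insert v U)))"
    using T by (simp add: koszul_wedge_def koszul_diff_def)
  also have "\<dots> = Var x * y T + (\<Sum>v\<in>- T. (koszul_sign x U * koszul_sign v U) * (Var v * y (insert v U)))"
    by (simp add: distrib_left sum_distrib_left mult_ac)
  also have "(\<Sum>v\<in>- T. (koszul_sign x U * koszul_sign v U) * (Var v * y (insert v U))) =
      - (\<Sum>v\<in>- T. koszul_sign v T * Var v * koszul_wedge x y (insert v T))"
    unfolding sum_negf[symmetric]
  proof (rule sum.cong)
    fix v assume "v \<in> - T"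
    then have v: "v \<notin> U" "v \<noteq> x" using T by auto
    have *: "insert v T - {x} = insert v U" using T v by auto
    have "koszul_sign v T * Var v * koszul_wedge x y (insert v T) =
        koszul_sign v (insert x U) * koszul_sign x (insert v U) * (Var v * y (insert v U))"
      unfolding koszul_wedge_def * using True T(1) by (simp add: mult_ac)
    also have "koszul_sign v (insert x U) * koszul_sign x (insert v U) =
        (- (koszul_sign x U * koszul_sign v U) :: ('a, 'b) mpoly)"
      using v T inj_vertex_index by (auto simp: koszul_sign_insert mult.commute dest: injD)
    finally show "(koszul_sign x U * koszul_sign v U) * (Var v * y (insert v U)) =
        - (koszul_sign v T * Var v * koszul_wedge x y (insert v T))" by simp
  qed simp
  finally show ?thesis by (simp add: koszul_diff_def[of "koszul_wedge x y"])
qed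

lemma homogeneous_koszul_diff:
  assumes "\<And>S. homogeneous (t - 1) (w S)"
  shows "homogeneous t (koszul_diff w T)"
proof -
  have "homogeneous t (koszul_sign v T * (Var v * w S))" for v S
  proof (cases "koszul_sign v T = (1 :: ('a, 'b) mpoly)")
    case True
    then show ?thesis using homogeneous_Var_mult[OF assms] by simp
  next
    case False
    then have "koszul_sign v T = (- 1 :: ('a, 'b) mpoly)"
      unfolding koszul_sign_def using neg_one_even_power neg_one_odd_power by blast
    then show ?thesis
      using homogeneous_uminus[OF homogeneous_Var_mult[OF assms]] by simp
  qed
  then show ?thesis
    unfolding koszul_diff_def by (intro homogeneous_sum) (simp add: mult.assoc)
qed

lemma homogeneous_koszul_wedge:
  assumes "\<And>S. homogeneous t (y S)"
  shows "homogeneous t (koszul_wedge x y S)"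
proof -
  have "koszul_sign x (S - {x}) = (1 :: ('a, 'b) mpoly) \<or> koszul_sign x (S - {x}) = (- 1 :: ('a, 'b) mpoly)"
    unfolding koszul_sign_def using neg_one_even_power neg_one_odd_power by blast
  then show ?thesis
    using assms homogeneous_uminus[OF assms] by (auto simp: koszul_wedge_def)
qed

section \<open>Strands of Koszul homology along the exact sequence of a variable\<close>

text \<open>
  The coefficients of a Koszul chain of homological degree \<open>p\<close> and internal degree \<open>j\<close> have degree
  \<open>j - p\<close>. Hence the following says \<open>Tor\<^sub>p(R/I, k)\<^bsub>p+t\<^esub> = 0\<close> for all \<open>p\<close> at once.
\<close>

definition koszul_strand_exact :: "('v::finite, 'k::field) mpoly set \<Rightarrow> int \<Rightarrow> bool" where
  "koszul_strand_exact I t \<longleftrightarrow>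
     (\<forall>z. (\<forall>S. homogeneous t (z S)) \<longrightarrow> (\<forall>T. koszul_diff z T \<in> I) \<longrightarrow>
        (\<exists>w. (\<forall>S. homogeneous (t - 1) (w S)) \<and> (\<forall>S. z S - koszul_diff w S \<in> I)))"

text \<open>
  Cycles modulo \<open>I\<close> are studied along \<open>0 \<rightarrow> R/(I : x)(-1) \<rightarrow> R/I \<rightarrow> R/(I, x) \<rightarrow> 0\<close>.
\<close>

lemma koszul_strand_decomp:
  assumes M: "up_closed M"
    and add: "koszul_strand_exact (monomial_ideal (monomial_add M x) :: ('v::finite, 'k::field) mpoly set) t"
    and hom: "\<And>S. homogeneous t (z S)"
    and cyc: "\<And>T. koszul_diff z T \<in> (monomial_ideal M :: ('v, 'k) mpoly set)"
  obtains w y where "\<And>S. homogeneous (t - 1) (w S)" "\<And>S. homogeneous (t - 1) (y S)"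
    "\<And>S. z S - koszul_diff w S - Var x * y S \<in> monomial_ideal M"
    "\<And>T. koszul_diff y T \<in> monomial_ideal (monomial_colon M x)"
proof -
  have "koszul_diff z T \<in> monomial_ideal (monomial_add M x)" for T
    using cyc by (rule monomial_ideal_mono[rotated]) (auto simp: monomial_add_def)
  with add hom obtain w where w: "\<And>S. homogeneous (t - 1) (w S)"
    "\<And>S. z S - koszul_diff w S \<in> monomial_ideal (monomial_add M x)"
    unfolding koszul_strand_exact_def by metis
  have "homogeneous t (z S - koszul_diff w S)" for S
    by (intro homogeneous_diff hom homogeneous_koszul_diff w)
  from monomial_add_decomp[OF w(2) this] obtain y where
    y: "\<And>S. z S - koszul_diff w S - Var x * y S \<in> monomial_ideal M" "\<And>S. homogeneous (t - 1) (y S)"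
    by metis
  have "koszul_diff y T \<in> monomial_ideal (monomial_colon M x)" for T
  proof (rule monomial_ideal_colon)
    \<comment> \<open>The boundary of \<open>w\<close> drops out since the differential squares to
      zero; what is left is a difference of two boundaries lying in the ideal.\<close>
    have "Var x * koszul_diff y T =
        koszul_diff z T - koszul_diff (\<lambda>S. z S - koszul_diff w S - Var x * y S) T"
      by (simp add: koszul_diff_diff koszul_diff_mult koszul_diff_koszul_diff)
    also have "\<dots> \<in> monomial_ideal M"
      by (intro monomial_ideal_diff cyc koszul_diff_in_monomial_ideal M y)
    finally show "Var x * koszul_diff y T \<in> monomial_ideal M" .
  qed
  with w(1) y show thesis using that by blast
qed

text \<open>Exactness of Tor at the middle term. The twist by -1 puts \<open>y\<close> into strand
  \<open>t - 1\<close> over the colon ideal; if \<open>u\<close> bounds it there, then x u bounds x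
  y.\<close>

lemma koszul_strand_exact_colon:
  fixes M :: "('v::finite \<Rightarrow>\<^sub>0 nat) set"
  assumes M: "up_closed M"
    and add: "koszul_strand_exact (monomial_ideal (monomial_add M x) :: ('v, 'k::field) mpoly set) t"
    and colon: "koszul_strand_exact (monomial_ideal (monomial_colon M x) :: ('v, 'k) mpoly set) (t - 1)"
  shows "koszul_strand_exact (monomial_ideal M :: ('v, 'k) mpoly set) t"
  unfolding koszul_strand_exact_def
proof (intro allI impI)
  fix z :: "'v set \<Rightarrow> ('v, 'k) mpoly"
  assume "\<forall>S. homogeneous t (z S)" "\<forall>T. koszul_diff z T \<in> monomial_ideal M"
  then obtain w y where w: "\<And>S. homogeneous (t - 1) (w S)" and y: "\<And>S. homogeneous (t - 1) (y S)"
    "\<And>S. z S - koszul_diff w S - Var x * y S \<in> monomial_ideal M"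
    "\<And>T. koszul_diff y T \<in> monomial_ideal (monomial_colon M x)"
    using koszul_strand_decomp[OF M add] by metis
  from colon y obtain u where u: "\<And>S. homogeneous (t - 1 - 1) (u S)"
    "\<And>S. y S - koszul_diff u S \<in> monomial_ideal (monomial_colon M x)"
    unfolding koszul_strand_exact_def by metis
  let ?w = "\<lambda>S. w S + Var x * u S"
  have "homogeneous (t - 1) (?w S)" for S
    by (intro homogeneous_add w homogeneous_Var_mult u)
  moreover have "z S - koszul_diff ?w S \<in> monomial_ideal M" for S
  proof -
    have "z S - koszul_diff ?w S = (z S - koszul_diff w S - Var x * y S) + Var x * (y S - koszul_diff u S)"
      by (simp add: koszul_diff_add koszul_diff_mult algebra_simps)
    then show ?thesis by (metis monomial_ideal_add monomial_ideal_colonD y(2) u(2))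
  qed
  ultimately show "\<exists>w. (\<forall>S. homogeneous (t - 1) (w S)) \<and> (\<forall>S. z S - koszul_diff w S \<in> monomial_ideal M)"
    by (intro exI[of _ ?w] conjI allI)
qed

text \<open>Here the error term \<open>x y\<close> is a boundary, since \<open>x\<close> annihilates Koszul homology.\<close>

lemma koszul_strand_exact_nonzerodivisor:
  fixes M :: "('v::finite \<Rightarrow>\<^sub>0 nat) set"
  assumes M: "up_closed M"
    and add: "koszul_strand_exact (monomial_ideal (monomial_add M x) :: ('v, 'k::field) mpoly set) t"
    and colon: "monomial_colon M x \<subseteq> M"
  shows "koszul_strand_exact (monomial_ideal M :: ('v, 'k) mpoly set) t"
  unfolding koszul_strand_exact_def
proof (intro allI impI)
  fix z :: "'v set \<Rightarrow> ('v, 'k) mpoly"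
  assume "\<forall>S. homogeneous t (z S)" "\<forall>T. koszul_diff z T \<in> monomial_ideal M"
  then obtain w y where w: "\<And>S. homogeneous (t - 1) (w S)" and y: "\<And>S. homogeneous (t - 1) (y S)"
    "\<And>S. z S - koszul_diff w S - Var x * y S \<in> monomial_ideal M"
    "\<And>T. koszul_diff y T \<in> monomial_ideal (monomial_colon M x)"
    using koszul_strand_decomp[OF M add] by metis
  \<comment> \<open>By \<open>koszul_diff_wedge\<close>, e_x y bounds x y up to e_x dy, and dy lies
    in the colon ideal, hence in the ideal itself.\<close>
  let ?w = "\<lambda>S. w S + koszul_wedge x y S"
  have "homogeneous (t - 1) (?w S)" for S
    by (intro homogeneous_add w homogeneous_koszul_wedge y)
  moreover have "z S - koszul_diff ?w S \<in> monomial_ideal M" for S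
  proof -
    have "koszul_wedge x (koszul_diff y) S \<in> monomial_ideal M"
      using monomial_ideal_mono[OF colon y(3)] by (auto simp: koszul_wedge_def intro: monomial_ideal_mult M)
    moreover have "z S - koszul_diff ?w S =
        (z S - koszul_diff w S - Var x * y S) + koszul_wedge x (koszul_diff y) S"
      by (simp add: koszul_diff_add koszul_diff_wedge algebra_simps)
    ultimately show ?thesis by (metis monomial_ideal_add y(2))
  qed
  ultimately show "\<exists>w. (\<forall>S. homogeneous (t - 1) (w S)) \<and> (\<forall>S. z S - koszul_diff w S \<in> monomial_ideal M)"
    by (intro exI[of _ ?w] conjI allI)
qed

section \<open>Edge ideals with some variables adjoined\<close>

text \<open>\<open>W\<close> acts as a set of deleted vertices: edges meeting it contribute nothing
  beyond its variables.\<close>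

definition edge_monomials :: "'v::finite set set \<Rightarrow> 'v set \<Rightarrow> ('v \<Rightarrow>\<^sub>0 nat) set" where
  "edge_monomials E W = {m. (\<exists>w\<in>W. Poly_Mapping.lookup m w \<noteq> 0) \<or>
     (\<exists>a b. {a, b} \<in> E \<and> Poly_Mapping.lookup m a \<noteq> 0 \<and> Poly_Mapping.lookup m b \<noteq> 0)}"

lemma up_closed_edge_monomials: "up_closed (edge_monomials E W)"
  unfolding up_closed_def edge_monomials_def by (auto simp: lookup_add)

lemma edge_monomials_insert: "monomial_add (edge_monomials E W) x = edge_monomials E (insert x W)"
  by (auto simp: monomial_add_def edge_monomials_def)

lemma simple_graph_neq: "simple_graph E \<Longrightarrow> {a, b} \<in> E \<Longrightarrow> a \<noteq> b"
  unfolding simple_graph_def by force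

text \<open>Multiplying by \<open>x\<close> supplies one end of every edge at \<open>x\<close>, so
  the other end suffices. There are no loops, and \<open>x \<notin> W\<close> keeps the colon from
  being the whole ring.\<close>

lemma edge_monomials_colon:
  assumes "simple_graph E" "x \<notin> W"
  shows "monomial_colon (edge_monomials E W) x = edge_monomials E (W \<union> {y. {x, y} \<in> E})"
proof -
  have *: "Poly_Mapping.lookup (Poly_Mapping.single x 1 + m) a \<noteq> 0 \<longleftrightarrow> a = x \<or> Poly_Mapping.lookup m a \<noteq> 0"
    for m :: "'a \<Rightarrow>\<^sub>0 nat" and a
    by (simp add: lookup_add lookup_single when_def)
  show ?thesis
    unfolding monomial_colon_def edge_monomials_def mem_Collect_eq *
    using assms simple_graph_neq[OF assms(1)] by (auto simp: insert_commute)
qed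

text \<open>The quotient is the field in degree 0, so coefficients of any other degree already lie
  in the ideal.\<close>

lemma koszul_strand_exact_irrelevant:
  assumes "t \<noteq> 0"
  shows "koszul_strand_exact (monomial_ideal {m. m \<noteq> 0} :: ('v::finite, 'k::field) mpoly set) t"
proof -
  have "z \<in> monomial_ideal {m. m \<noteq> 0}" if "homogeneous t z" for z :: "('v, 'k) mpoly"
    using that assms by (auto simp: monomial_ideal_def homogeneous_def)
  moreover have "koszul_diff (\<lambda>_. 0) S = (0 :: ('v, 'k) mpoly)" for S
    by (simp add: koszul_diff_def)
  ultimately show ?thesis
    unfolding koszul_strand_exact_def
    by (intro allI impI exI[of _ "\<lambda>_. 0"]) simp
qed

lemma edge_monomials_UNIV: "edge_monomials E UNIV = {m. m \<noteq> 0}"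
  by (auto simp: edge_monomials_def poly_mapping_eq_iff fun_eq_iff)

text \<open>A remaining vertex has all its neighbours in \<open>W\<close>, hence is a
  nonzerodivisor, and vanishing may be checked after adjoining it. Adjoining all of them ends at the
  maximal ideal.\<close>

lemma koszul_strand_exact_independent:
  assumes "simple_graph E" "independent_set E (- W)" "t > 0"
  shows "koszul_strand_exact (monomial_ideal (edge_monomials E W) :: ('v::finite, 'k::field) mpoly set) t"
  using assms(2)
proof (induction "card (- W)" arbitrary: W rule: less_induct)
  case less
  show ?case
  proof (cases "W = UNIV")
    case True
    then show ?thesis
      using koszul_strand_exact_irrelevant[of t] assms(3) by (simp add: edge_monomials_UNIV)
  next
    case False
    then obtain x where x: "x \<notin> W" by blast
    show ?thesis
    proof (rule koszul_strand_exact_nonzerodivisor[OF up_closed_edge_monomials])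
      show "koszul_strand_exact (monomial_ideal (monomial_add (edge_monomials E W) x) :: ('v, 'k) mpoly set) t"
        unfolding edge_monomials_insert
        by (rule less.hyps) (use x less.prems in \<open>auto simp: independent_set_def intro!: psubset_card_mono\<close>)
      have "W \<union> {y. {x, y} \<in> E} = W"
        using less.prems x by (auto simp: independent_set_def)
      then show "monomial_colon (edge_monomials E W) x \<subseteq> edge_monomials E W"
        using edge_monomials_colon[OF assms(1) x] by simp
    qed
  qed
qed

text \<open>Both ends of the exact sequence enlarge \<open>W\<close>, so it must be general. The
  outer induction is on the number of cliques, the inner on the vertices outside
  \<open>W\<close>.\<close>

lemma koszul_strand_exact_clique_cover:
  assumes E: "simple_graph E" and J0: "independent_set E (J 0)"
    and J: "\<And>i. i \<in> {1..s} \<Longrightarrow> clique E (J i)"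
    and W: "- W \<subseteq> (\<Union>i\<in>{0..s}. J i)" and t: "t > int s"
  shows "koszul_strand_exact (monomial_ideal (edge_monomials E W) :: ('v::finite, 'k::field) mpoly set) t"
  using J W t
proof (induction s arbitrary: W t)
  case 0
  then have "independent_set E (- W)"
    using J0 by (auto simp: independent_set_def)
  with 0 show ?case by (intro koszul_strand_exact_independent E) auto
next
  case (Suc s)
  have cl: "clique E (J (Suc s))" and cl': "\<And>i. i \<in> {1..s} \<Longrightarrow> clique E (J i)"
    using Suc.prems(1) by auto
  have split: "(\<Union>i\<in>{0..Suc s}. J i) = (\<Union>i\<in>{0..s}. J i) \<union> J (Suc s)"
    by (auto simp: atLeastAtMostSuc_conv)
  show ?case
    using Suc.prems(2)
  proof (induction "card (- W)" arbitrary: W rule: less_induct)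
    case less
    show ?case
    proof (cases "J (Suc s) \<subseteq> W")
      case True
      then show ?thesis
        using less.prems Suc.prems(3) unfolding split by (intro Suc.IH cl') auto
    next
      case False
      then obtain x where x: "x \<in> J (Suc s)" "x \<notin> W" by blast
      let ?N = "W \<union> {y. {x, y} \<in> E}"
      have xN: "x \<notin> ?N" using x simple_graph_neq[OF E, of x x] by auto
      \<comment> \<open>The closed neighbourhood of \<open>x\<close> swallows the last clique, so
        \<open>s\<close> cliques remain.\<close>
      have cover: "- insert x ?N \<subseteq> (\<Union>i\<in>{0..s}. J i)"
      proof
        fix y assume y: "y \<in> - insert x ?N"
        then have "y \<notin> J (Suc s)" using cl x by (auto simp: clique_def)
        with y less.prems show "y \<in> (\<Union>i\<in>{0..s}. J i)" unfolding split by auto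
      qed
      show ?thesis
      proof (rule koszul_strand_exact_colon[OF up_closed_edge_monomials])
        show "koszul_strand_exact (monomial_ideal (monomial_add (edge_monomials E W) x) :: ('v, 'k) mpoly set) t"
          unfolding edge_monomials_insert
          by (rule less.hyps) (use x less.prems in \<open>auto intro!: psubset_card_mono\<close>)
        have "koszul_strand_exact (monomial_ideal (edge_monomials E (insert x ?N)) :: ('v, 'k) mpoly set) (t - 1)"
          using cover Suc.prems(3) by (intro Suc.IH cl') auto
        \<comment> \<open>The colon ideal does not adjoin \<open>x\<close> itself, but it adjoins
          all neighbours of \<open>x\<close>, so \<open>x\<close> is a nonzerodivisor there.\<close>
        then have "koszul_strand_exact (monomial_ideal (edge_monomials E ?N) :: ('v, 'k) mpoly set) (t - 1)"
          unfolding edge_monomials_insert[symmetric]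
          by (rule koszul_strand_exact_nonzerodivisor[OF up_closed_edge_monomials])
            (use edge_monomials_colon[OF E xN] in \<open>simp add: Un_assoc\<close>)
        then show "koszul_strand_exact
            (monomial_ideal (monomial_colon (edge_monomials E W) x) :: ('v, 'k) mpoly set) (t - 1)"
          unfolding edge_monomials_colon[OF E x(2)] .
      qed
    qed
  qed
qed

section \<open>Minimal resolutions\<close>

lemma monomial_ideal_empty [simp]: "monomial_ideal {} = {0}"
  by (auto simp: monomial_ideal_def)

text \<open>The boundary at \<open>T\<close> is a linear form with coefficients, up to sign, the
  constants \<open>z (insert v T)\<close>, and variables are linearly independent. Only
  \<open>z {}\<close> never occurs so, hence its own hypothesis.\<close>

lemma koszul_cycle_of_constants:
  fixes z :: "'v::finite set \<Rightarrow> ('v, 'k::field) mpoly"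
  assumes const: "\<And>S. Poly_Mapping.keys (z S) \<subseteq> {0}"
    and cyc: "\<And>T. koszul_diff z T = 0"
    and z0: "z {} \<in> monomial_ideal {m. m \<noteq> 0}"
  shows "z S = 0"
proof (cases "S = {}")
  case True
  with const[of S] z0 have "Poly_Mapping.keys (z S) = {}" by (fastforce simp: monomial_ideal_def)
  then show ?thesis by simp
next
  case False
  then obtain v where v: "v \<in> S" by blast
  define T where "T = S - {v}"
  \<comment> \<open>Modulo the variables other than \<open>v\<close>, only the \<open>v\<close>-term
    of the boundary survives.\<close>
  let ?N = "{m. \<exists>u. u \<noteq> v \<and> Poly_Mapping.lookup m u \<noteq> 0}"
  have N: "up_closed ?N" by (auto simp: up_closed_def lookup_add)
  have T: "- T = insert v (- S)" "insert v T = S" using v by (auto simp: T_def)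
  let ?r = "\<Sum>u\<in>- S. koszul_sign u T * Var u * z (insert u T)"
  have "Var u \<in> (monomial_ideal ?N :: ('v, 'k) mpoly set)" if "u \<in> - S" for u
    using that v by (auto simp: monomial_ideal_def Var_def lookup_single when_def)
  then have "koszul_sign u T * Var u * z (insert u T) \<in> monomial_ideal ?N" if "u \<in> - S" for u
    using that by (intro monomial_ideal_mult_right[OF N] monomial_ideal_mult[OF N, of "Var u"])
  then have "?r \<in> monomial_ideal ?N"
    by (rule monomial_ideal_sum)
  moreover have "koszul_sign v T * Var v * z S + ?r = 0"
    using cyc[of T] v by (simp add: koszul_diff_def T)
  ultimately have "koszul_sign v T * Var v * z S \<in> monomial_ideal ?N"
    using monomial_ideal_uminus[of ?r] by (simp add: eq_neg_iff_add_eq_0[symmetric])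
  then have "koszul_sign v T * (koszul_sign v T * (Var v * z S)) \<in> monomial_ideal ?N"
    by (intro monomial_ideal_mult[OF N, of "koszul_sign v T * (Var v * z S)"]) (simp add: mult.assoc)
  then have "Var v * z S \<in> monomial_ideal ?N" by simp
  then have "z S \<in> monomial_ideal (monomial_colon ?N v)"
    by (rule monomial_ideal_colon)
  then have "Poly_Mapping.keys (z S) \<subseteq> monomial_colon ?N v"
    unfolding monomial_ideal_def by (rule CollectD)
  moreover have "0 \<notin> monomial_colon ?N v"
    by (auto simp: monomial_colon_def lookup_single when_def split: if_splits)
  ultimately have "Poly_Mapping.keys (z S) = {}"
    using const[of S] by blast
  then show ?thesis by simp
qed

text \<open>The Koszul complex resolves the field; its only homology, in homological degree 0, is
  excluded by the condition on \<open>z {}\<close>.\<close>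

lemma koszul_exact:
  fixes z :: "'v::finite set \<Rightarrow> ('v, 'k::field) mpoly"
  assumes hom: "\<And>S. homogeneous t (z S)"
    and cyc: "\<And>T. koszul_diff z T = 0"
    and z0: "z {} \<in> monomial_ideal {m. m \<noteq> 0}"
  shows "\<exists>w. (\<forall>S. homogeneous (t - 1) (w S)) \<and> (\<forall>S. z S = koszul_diff w S)"
proof (cases "t > 0")
  case True
  \<comment> \<open>The zero ideal is the edge ideal of the edgeless graph.\<close>
  then have "koszul_strand_exact (monomial_ideal {} :: ('v, 'k) mpoly set) t"
    using koszul_strand_exact_independent[of "{}" "{} :: 'v set" t]
    by (simp add: simple_graph_def independent_set_def edge_monomials_def)
  then show ?thesis
    unfolding koszul_strand_exact_def using hom cyc by simp
next
  case False
  then have "Poly_Mapping.keys (z S) \<subseteq> {0}" for S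
    using hom[of S] by (auto simp: homogeneous_def)
  then have "z S = 0" for S
    using koszul_cycle_of_constants cyc z0 by blast
  then show ?thesis
    by (intro exI[of _ "\<lambda>_. 0"]) (simp add: koszul_diff_def)
qed

section \<open>Comparison of a minimal resolution with the Koszul complex\<close>

text \<open>
  The complex \<open>\<dots> \<rightarrow> G\<^sub>2 \<rightarrow> G\<^sub>1 \<rightarrow> G\<^sub>0 = R\<close>, where \<open>G\<^sub>1, G\<^sub>2, \<dots>\<close> is a minimal
  resolution of \<open>R/I\<close>; equalities in \<open>G\<^sub>0\<close> only hold modulo \<open>I\<close>.
\<close>

locale augmented_minimal_resolution =
  fixes M :: "('v::finite \<Rightarrow>\<^sub>0 nat) set"
    and rank :: "nat \<Rightarrow> nat"
    and deg :: "nat \<Rightarrow> nat \<Rightarrow> int"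
    and B :: "nat \<Rightarrow> nat \<Rightarrow> nat \<Rightarrow> ('v, 'k::field) mpoly"
    and app :: "nat \<Rightarrow> (nat \<Rightarrow> ('v, 'k) mpoly) \<Rightarrow> nat \<Rightarrow> ('v, 'k) mpoly"
  defines "app q v a \<equiv> \<Sum>b<rank (Suc q). B q a b * v b"
  assumes up_closed: "up_closed M"
    and rank_0: "rank 0 = 1" and deg_0: "deg 0 0 = 0"
    and homogeneous_B: "\<And>q a b. a < rank q \<Longrightarrow> b < rank (Suc q) \<Longrightarrow>
      homogeneous (deg (Suc q) b - deg q a) (B q a b)"
    and minimal_B: "\<And>q a b. a < rank (Suc q) \<Longrightarrow> b < rank (Suc (Suc q)) \<Longrightarrow>
      B (Suc q) a b \<in> monomial_ideal {m. m \<noteq> 0}"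
    and surj: "\<And>p. \<exists>v. p - app 0 v 0 \<in> monomial_ideal M"
    and exact: "\<And>q v. (\<forall>a<rank q. app q v a \<in> monomial_ideal (if q = 0 then M else {})) \<longleftrightarrow>
      (\<exists>w. \<forall>b<rank (Suc q). v b = app (Suc q) w b)"
begin

lemma app_cong: "(\<And>b. b < rank (Suc q) \<Longrightarrow> v b = w b) \<Longrightarrow> app q v a = app q w a"
  unfolding app_def by (rule sum.cong) auto

lemma app_diff: "app q (\<lambda>b. v b - w b) a = app q v a - app q w a"
  unfolding app_def by (simp add: right_diff_distrib sum_subtractf)

lemma koszul_diff_app: "koszul_diff (\<lambda>S. app q (c S) a) T = app q (\<lambda>b. koszul_diff (\<lambda>S. c S b) T) a"
  unfolding app_def by (simp add: koszul_diff_sum koszul_diff_mult)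

lemma app_minimal: "a < rank (Suc q) \<Longrightarrow> app (Suc q) v a \<in> monomial_ideal {m. m \<noteq> 0}"
  unfolding app_def
proof (rule monomial_ideal_sum)
  fix b assume "a < rank (Suc q)" "b \<in> {..<rank (Suc (Suc q))}"
  then show "B (Suc q) a b * v b \<in> monomial_ideal {m. m \<noteq> 0}"
    by (intro monomial_ideal_mult_right up_closed_nonzero minimal_B) auto
qed

lemma homogeneous_app:
  assumes "\<And>b. b < rank (Suc q) \<Longrightarrow> homogeneous (t - deg (Suc q) b) (v b)" "a < rank q"
  shows "homogeneous (t - deg q a) (app q v a)"
  unfolding app_def
proof (rule homogeneous_sum)
  fix b assume "b \<in> {..<rank (Suc q)}"
  then show "homogeneous (t - deg q a) (B q a b * v b)"
    using homogeneous_mult[OF homogeneous_B assms(1), of a q b b] assms(2) by simp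
qed

text \<open>
  This is the diagram chase in the double complex \<open>K \<otimes> G\<close> that compares the two ways of
  computing \<open>Tor(R/I, k)\<close>.
\<close>

lemma zigzag:
  assumes van: "koszul_strand_exact (monomial_ideal M :: ('v, 'k) mpoly set) t"
    and hom: "\<And>S a. a < rank (Suc q) \<Longrightarrow> homogeneous (t + int q - deg (Suc q) a) (c S a)"
    and cyc: "\<And>T a. a < rank q \<Longrightarrow>
      koszul_diff (\<lambda>S. app q (c S) a) T \<in> monomial_ideal (if q = 0 then M else {})"
  shows "\<exists>u y. \<forall>S. \<forall>a<rank (Suc q). c S a = koszul_diff (\<lambda>S. u S a) S + app (Suc q) (y S) a"
  using hom cyc
proof (induction q arbitrary: c)
  case 0
  \<comment> \<open>The image of \<open>c\<close> in R is a cycle over R/I in strand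
    \<open>t\<close>; there it is bounded by some \<open>w\<close>, which lifts along
    \<open>surj\<close> to \<open>u\<close>.\<close>
  let ?z = "\<lambda>S. app 0 (c S) 0"
  have "homogeneous t (?z S)" for S
    using homogeneous_app[of 0 t "c S" 0] 0 by (simp add: rank_0 deg_0)
  moreover have "koszul_diff ?z T \<in> monomial_ideal M" for T
    using 0(2)[of 0 T] by (simp add: rank_0)
  ultimately obtain w where w: "\<And>S. ?z S - koszul_diff w S \<in> monomial_ideal M"
    using van[unfolded koszul_strand_exact_def, rule_format, of ?z] by blast
  obtain u where u: "\<And>S. w S - app 0 (u S) 0 \<in> monomial_ideal M"
    using choice[of "\<lambda>S v. w S - app 0 v 0 \<in> monomial_ideal M"] surj by blast
  have "\<exists>y. \<forall>a<rank 1. c S a - koszul_diff (\<lambda>S. u S a) S = app 1 y a" for S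
  proof -
    have "app 0 (\<lambda>b. c S b - koszul_diff (\<lambda>S. u S b) S) 0 =
        (?z S - koszul_diff w S) + koszul_diff (\<lambda>S. w S - app 0 (u S) 0) S"
      by (simp add: app_diff koszul_diff_diff koszul_diff_app)
    also have "\<dots> \<in> monomial_ideal M"
      by (intro monomial_ideal_add w koszul_diff_in_monomial_ideal up_closed u)
    finally show ?thesis
      using exact[of 0 "\<lambda>b. c S b - koszul_diff (\<lambda>S. u S b) S"] by (simp add: rank_0)
  qed
  then obtain y where "\<And>S a. a < rank 1 \<Longrightarrow> c S a - koszul_diff (\<lambda>S. u S a) S = app 1 (y S) a"
    by metis
  then show ?case
    by (intro exI[of _ u] exI[of _ y]) (auto simp: algebra_simps)
next
  case (Suc q)
  \<comment> \<open>The image of \<open>c\<close> is a Koszul cycle over R. Minimality puts its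
    entries into the maximal ideal, so \<open>koszul_exact\<close> yields a bounding
    \<open>c'\<close>, one degree lower as the hypothesis for \<open>q\<close> requires.\<close>
  have "\<exists>w. (\<forall>S. homogeneous (t + int q - deg (Suc q) a) (w S)) \<and>
      (\<forall>S. app (Suc q) (c S) a = koszul_diff w S)" if a: "a < rank (Suc q)" for a
  proof -
    have "homogeneous (t + int (Suc q) - deg (Suc q) a) (app (Suc q) (c S) a)" for S
      by (rule homogeneous_app) (use Suc.prems a in auto)
    from koszul_exact[OF this _ app_minimal[OF a]] Suc.prems(2)[OF a]
    show ?thesis by (simp add: algebra_simps)
  qed
  then obtain c' where c': "\<And>S a. a < rank (Suc q) \<Longrightarrow> homogeneous (t + int q - deg (Suc q) a) (c' a S)"
    "\<And>S a. a < rank (Suc q) \<Longrightarrow> app (Suc q) (c S) a = koszul_diff (c' a) S"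
    by metis
  \<comment> \<open>The boundary of the image of \<open>c'\<close> is \<open>c\<close> under two
    consecutive maps, hence zero, or in the ideal if \<open>q = 0\<close>.\<close>
  have "koszul_diff (\<lambda>S. app q (\<lambda>a. c' a S) a) T \<in> monomial_ideal (if q = 0 then M else {})"
    if a: "a < rank q" for T a
  proof -
    have "koszul_diff (\<lambda>S. app q (\<lambda>a. c' a S) a) T = app q (app (Suc q) (c T)) a"
      unfolding koszul_diff_app by (rule app_cong) (simp add: c')
    with exact[of q "app (Suc q) (c T)"] a show ?thesis by auto
  qed
  with Suc.IH[of "\<lambda>S a. c' a S"] c'(1) obtain u y where
    uy: "\<And>S a. a < rank (Suc q) \<Longrightarrow> c' a S = koszul_diff (\<lambda>S. u S a) S + app (Suc q) (y S) a"
    by blast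
  \<comment> \<open>The \<open>y\<close> found for \<open>c'\<close> serves as the new
    \<open>u\<close>: \<open>c'\<close> and the image of \<open>y\<close> have the same boundary, so
    \<open>c\<close> minus the boundary of \<open>y\<close> lies in the kernel.\<close>
  have "\<exists>v. \<forall>a<rank (Suc (Suc q)). c S a - koszul_diff (\<lambda>S. y S a) S = app (Suc (Suc q)) v a" for S
  proof -
    have "app (Suc q) (\<lambda>b. c S b - koszul_diff (\<lambda>S. y S b) S) a = 0" if a: "a < rank (Suc q)" for a
    proof -
      have "c' a = (\<lambda>S. koszul_diff (\<lambda>S. u S a) S + app (Suc q) (y S) a)"
        using uy[OF a] by blast
      then have "koszul_diff (c' a) S = koszul_diff (\<lambda>S. app (Suc q) (y S) a) S"
        by (simp add: koszul_diff_add koszul_diff_koszul_diff)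
      then show ?thesis by (simp add: app_diff koszul_diff_app c'(2)[OF a])
    qed
    with exact[of "Suc q" "\<lambda>b. c S b - koszul_diff (\<lambda>S. y S b) S"] show ?thesis by simp
  qed
  then obtain v where "\<And>S a. a < rank (Suc (Suc q)) \<Longrightarrow>
      c S a - koszul_diff (\<lambda>S. y S a) S = app (Suc (Suc q)) (v S) a"
    by metis
  then show ?case
    by (intro exI[of _ y] exI[of _ v]) (auto simp: algebra_simps)
qed

text \<open>The zigzag would write a basis element as a Koszul boundary plus an image under a
  minimal map; both have entries in the maximal ideal, which does not contain 1.\<close>

lemma no_generator_in_exact_strand:
  assumes van: "koszul_strand_exact (monomial_ideal M :: ('v, 'k) mpoly set) (deg (Suc i) b - int i)"
    and b: "b < rank (Suc i)"
  shows False
proof -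
  \<comment> \<open>The basis element \<open>b\<close> in Koszul degree 0, where everything is a
    cycle. Its coefficient 1 has degree 0, which fixes the strand
    \<open>deg (Suc i) b - int i\<close>.\<close>
  define c :: "'v set \<Rightarrow> nat \<Rightarrow> ('v, 'k) mpoly" where "c S a = (if S = {} \<and> a = b then 1 else 0)" for S a
  have "\<exists>u y. \<forall>S. \<forall>a<rank (Suc i). c S a = koszul_diff (\<lambda>S. u S a) S + app (Suc i) (y S) a"
  proof (rule zigzag[OF van])
    show "homogeneous (deg (Suc i) b - int i + int i - deg (Suc i) a) (c S a)" for S a
      by (simp add: c_def homogeneous_one)
    show "koszul_diff (\<lambda>S. app i (c S) a) T \<in> monomial_ideal (if i = 0 then M else {})" for T a
      by (simp add: koszul_diff_def app_def c_def)
  qed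
  then obtain u :: "'v set \<Rightarrow> nat \<Rightarrow> ('v, 'k) mpoly" and y :: "'v set \<Rightarrow> nat \<Rightarrow> ('v, 'k) mpoly"
    where "c {} b = koszul_diff (\<lambda>S. u S b) {} + app (Suc i) (y {}) b"
    using b by blast
  moreover have "koszul_diff (\<lambda>S. u S b) {} \<in> monomial_ideal {m. m \<noteq> 0}"
    unfolding koszul_diff_def
    by (intro monomial_ideal_sum monomial_ideal_mult_right[OF up_closed_nonzero]
        monomial_ideal_mult[OF up_closed_nonzero Var_in_monomial_ideal_nonzero])
  ultimately have "1 \<in> (monomial_ideal {m. m \<noteq> 0} :: ('v, 'k) mpoly set)"
    using monomial_ideal_add[OF _ app_minimal[OF b, of "y {}"]] by (metis c_def)
  then show False by (simp add: monomial_ideal_def)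
qed

end

section \<open>From the given definitions of ideals and resolutions to exponent sets and the
  augmented complex\<close>

lemma module_times: "Modules.module ((*) :: 'a::comm_ring_1 \<Rightarrow> 'a \<Rightarrow> 'a)"
  by unfold_locales (simp_all add: algebra_simps)

lemma ideal_generated_subset_monomial_ideal:
  assumes "up_closed M" "S \<subseteq> monomial_ideal M"
  shows "ideal_generated S \<subseteq> monomial_ideal M"
  unfolding ideal_generated_def using assms
  by (intro module.span_minimal module_times)
    (auto simp: module.subspace_def[OF module_times] intro: monomial_ideal_add monomial_ideal_mult)

lemma irrelevant_ideal_subset: "irrelevant_ideal \<subseteq> (monomial_ideal {m. m \<noteq> 0} :: ('v::finite, 'k::field) mpoly set)"
  unfolding irrelevant_ideal_def
  by (rule ideal_generated_subset_monomial_ideal) (auto intro: up_closed_nonzero Var_in_monomial_ideal_nonzero)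

lemma edge_ideal_eq_monomial_ideal:
  assumes E: "simple_graph E"
  shows "edge_ideal E = (monomial_ideal (edge_monomials E {}) :: ('v::finite, 'k::field) mpoly set)"
proof
  show "edge_ideal E \<subseteq> (monomial_ideal (edge_monomials E {}) :: ('v, 'k) mpoly set)"
    unfolding edge_ideal_def
  proof (rule ideal_generated_subset_monomial_ideal[OF up_closed_edge_monomials], clarify)
    fix x y assume "{x, y} \<in> E"
    then have "Poly_Mapping.single x 1 + Poly_Mapping.single y 1 \<in> edge_monomials E {}"
      unfolding edge_monomials_def
      by (intro CollectI disjI2 exI[of _ x] exI[of _ y]) (simp add: lookup_add lookup_single)
    then show "Var x * Var y \<in> (monomial_ideal (edge_monomials E {}) :: ('v, 'k) mpoly set)"
      by (simp add: monomial_ideal_def Var_def mult_single)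
  qed
  show "(monomial_ideal (edge_monomials E {}) :: ('v, 'k) mpoly set) \<subseteq> edge_ideal E"
  proof
    fix p :: "('v, 'k) mpoly"
    assume p: "p \<in> monomial_ideal (edge_monomials E {})"
    have "Poly_Mapping.single m k \<in> (edge_ideal E :: ('v, 'k) mpoly set)"
      if m: "m \<in> Poly_Mapping.keys p" for m k
    proof -
      from p m obtain a b where ab: "{a, b} \<in> E" "Poly_Mapping.lookup m a \<noteq> 0" "Poly_Mapping.lookup m b \<noteq> 0"
        by (auto simp: monomial_ideal_def edge_monomials_def)
      let ?e = "Poly_Mapping.single a 1 + Poly_Mapping.single b (1::nat)"
      \<comment> \<open>As \<open>a\<close> and \<open>b\<close> are distinct, \<open>?e\<close> has
        exponents at most 1 and the truncated subtraction is exact.\<close>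
      have m_eq: "m = (m - ?e) + ?e"
        using ab simple_graph_neq[OF E ab(1)]
        by (intro poly_mapping_eqI) (auto simp: lookup_add lookup_minus lookup_single when_def)
      have "Poly_Mapping.single m k = Poly_Mapping.single (m - ?e) k * (Var a * Var b)"
        unfolding Var_def mult_single mult_1_right m_eq[symmetric] ..
      also have "\<dots> \<in> edge_ideal E"
        unfolding edge_ideal_def ideal_generated_def using ab(1)
        by (intro module.span_scale[OF module_times] module.span_base[OF module_times]) blast
      finally show ?thesis .
    qed
    then have "(\<Sum>m\<in>Poly_Mapping.keys p. Poly_Mapping.single m (Poly_Mapping.lookup p m)) \<in> edge_ideal E"
      unfolding edge_ideal_def ideal_generated_def by (intro module.span_sum[OF module_times])
    then show "p \<in> edge_ideal E" by (simp flip: poly_mapping_eq_sum_single)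
  qed
qed

text \<open>Positions shift by one: R takes position 0 and \<open>\<epsilon>\<close> becomes the map
  with index 0. Exactness at R/I turns into \<open>surj\<close>, exactness at F_0 into the case
  \<open>q = 0\<close> of \<open>exact\<close>.\<close>

lemma minimal_resolution_augmented:
  assumes E: "simple_graph E"
    and min: "minimal_graded_free_resolution (edge_ideal E :: ('v::finite, 'k::field) mpoly set) d D \<epsilon>"
  shows "augmented_minimal_resolution (edge_monomials E {})
    (\<lambda>q. case q of 0 \<Rightarrow> 1 | Suc q \<Rightarrow> length (d q))
    (\<lambda>q a. case q of 0 \<Rightarrow> 0 | Suc q \<Rightarrow> d q ! a)
    (\<lambda>q a b. case q of 0 \<Rightarrow> \<epsilon> $ b | Suc q \<Rightarrow> D q $$ (a, b))"
proof -
  let ?I = "monomial_ideal (edge_monomials E {}) :: ('v, 'k) mpoly set"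
  note R = min[unfolded minimal_graded_free_resolution_def graded_free_resolution_def
      edge_ideal_eq_monomial_ideal[OF E]]
  note R1 = R[THEN conjunct1]
  note R4 = R1[THEN conjunct2, THEN conjunct2, THEN conjunct2]
  note eps_hom = R1[THEN conjunct2, THEN conjunct1, rule_format]
  note D = R1[THEN conjunct2, THEN conjunct2, THEN conjunct1, rule_format]
  note D_hom = R4[THEN conjunct1, rule_format]
  note surj = R4[THEN conjunct2, THEN conjunct1, rule_format]
  note ex0 = R4[THEN conjunct2, THEN conjunct2, THEN conjunct1]
  note ex = R4[THEN conjunct2, THEN conjunct2, THEN conjunct2, rule_format]
  note D_min = R[THEN conjunct2, rule_format]
  have eps_app: "(\<Sum>b<length (d 0). \<epsilon> $ b * v b) = \<epsilon> \<bullet> vec (length (d 0)) v" for v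
    by (simp add: scalar_prod_def lessThan_atLeast0)
  have D_app: "(\<Sum>b<length (d (Suc i)). D i $$ (a, b) * v b) = (D i *\<^sub>v vec (length (d (Suc i))) v) $ a"
    if "a < length (d i)" for i a v
    using D[of i] that by (simp add: scalar_prod_def lessThan_atLeast0)
  have image: "vec (length (d i)) v \<in> (\<lambda>w. D i *\<^sub>v w) ` carrier_vec (length (d (Suc i))) \<longleftrightarrow>
      (\<exists>w. \<forall>a<length (d i). v a = (\<Sum>b<length (d (Suc i)). D i $$ (a, b) * w b))" for i v
  proof
    assume "vec (length (d i)) v \<in> (\<lambda>w. D i *\<^sub>v w) ` carrier_vec (length (d (Suc i)))"
    then obtain w where w: "w \<in> carrier_vec (length (d (Suc i)))" "vec (length (d i)) v = D i *\<^sub>v w" by blast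
    then have "v a = (D i *\<^sub>v vec (length (d (Suc i))) (($) w)) $ a" if "a < length (d i)" for a
      using that by (metis carrier_vecD index_vec vec_eq_iff dim_vec eq_vecI)
    then show "\<exists>w. \<forall>a<length (d i). v a = (\<Sum>b<length (d (Suc i)). D i $$ (a, b) * w b)"
      by (intro exI[of _ "($) w"]) (simp add: D_app)
  next
    assume "\<exists>w. \<forall>a<length (d i). v a = (\<Sum>b<length (d (Suc i)). D i $$ (a, b) * w b)"
    then obtain w where "\<And>a. a < length (d i) \<Longrightarrow> v a = (D i *\<^sub>v vec (length (d (Suc i))) w) $ a"
      by (auto simp: D_app)
    then have "vec (length (d i)) v = D i *\<^sub>v vec (length (d (Suc i))) w"
      using D[of i] by (intro eq_vecI) auto
    then show "vec (length (d i)) v \<in> (\<lambda>w. D i *\<^sub>v w) ` carrier_vec (length (d (Suc i)))" by auto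
  qed
  have kernel: "vec (length (d (Suc i))) v \<in> mat_kernel (D i) \<longleftrightarrow>
      (\<forall>a<length (d i). (\<Sum>b<length (d (Suc i)). D i $$ (a, b) * v b) = 0)" for i v
    using D[of i] by (auto simp: mat_kernel_def D_app vec_eq_iff)
  show ?thesis
  proof (unfold_locales, goal_cases)
    case 1
    show ?case by (rule up_closed_edge_monomials)
  next
    case (4 q a b)
    then show ?case by (cases q) (auto simp: eps_hom D_hom)
  next
    case (5 q a b)
    then show ?case using D_min irrelevant_ideal_subset by auto
  next
    case (6 p)
    obtain v where "v \<in> carrier_vec (length (d 0))" "p - \<epsilon> \<bullet> v \<in> ?I"
      using surj by blast
    then have "p - \<epsilon> \<bullet> vec (length (d 0)) (($) v) \<in> ?I"
      by (metis carrier_vecD vec_eq_iff dim_vec index_vec eq_vecI)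
    then show ?case by (auto simp: eps_app)
  next
    case (7 q v)
    show ?case
    proof (cases q)
      case 0
      have "vec (length (d 0)) v \<in> {v \<in> carrier_vec (length (d 0)). \<epsilon> \<bullet> v \<in> ?I} \<longleftrightarrow>
          \<epsilon> \<bullet> vec (length (d 0)) v \<in> ?I" by simp
      with image[of 0 v] show ?thesis unfolding ex0 by (simp add: 0 eps_app)
    next
      case (Suc i)
      with kernel[of i v] image[of "Suc i" v] show ?thesis unfolding ex by simp
    qed
  qed simp_all
qed

theorem theorem1p2:
  fixes E :: "'v::finite set set"
    and J :: "nat \<Rightarrow> 'v set"
    and s :: nat
  assumes "simple_graph E"
    and "(\<Union>i\<in>{0..s}. J i) = UNIV"
    and "disjoint_family_on J {0..s}"
    and "independent_set E (J 0)"
    and "\<And>i. i \<in> {1..s} \<Longrightarrow> clique E (J i)"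
  shows "cm_regularity_quotient (edge_ideal E :: ('v, 'k::field) mpoly set) \<le> ereal (real s)"
proof -
  have "j - int i \<le> int s"
    if min: "minimal_graded_free_resolution (edge_ideal E :: ('v, 'k) mpoly set) d D \<epsilon>"
      and j: "j \<in> set (d i)" for i j d D \<epsilon>
  proof (rule ccontr)
    assume "\<not> j - int i \<le> int s"
    then have van: "koszul_strand_exact (monomial_ideal (edge_monomials E {}) :: ('v, 'k) mpoly set) (j - int i)"
      using assms by (intro koszul_strand_exact_clique_cover[where J = J and s = s]) auto
    from j obtain b where "b < length (d i)" "d i ! b = j"
      by (auto simp: in_set_conv_nth)
    \<comment> \<open>Position \<open>Suc i\<close> of the augmented complex is position
      \<open>i\<close> of the resolution, so \<open>j\<close> is the degree of a generator in a
      vanishing strand.\<close>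
    with van show False
      using augmented_minimal_resolution.no_generator_in_exact_strand
        [OF minimal_resolution_augmented[OF assms(1) min], where i = i and b = b] by simp
  qed
  then have "real_of_int (j - int i) \<le> real s"
    if "minimal_graded_free_resolution (edge_ideal E :: ('v, 'k) mpoly set) d D \<epsilon>" "j \<in> set (d i)" for i j d D \<epsilon>
    using that by (metis of_int_le_iff of_int_of_nat_eq)
  then show ?thesis
    unfolding cm_regularity_quotient_def by (intro Sup_least) auto
qed

end
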